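(* Let $\alpha<1$ be real, let $f(z)=z+\sum_{n=2}^{\infty}a_nz^n\in H\mathcal{S}^*(\alpha)$, and let $\lambda\in\mathbb{R}$. Then for all integers $n,m\ge 2$, $$|\lambda a_na_m-a_{n+m-1}|\le\begin{cases}A_{n+m-1}, & 0\le\lambda\le \dfrac{2A_{n+m-1}}{A_nA_m},\\[2mm] |\lambda A_nA_m-A_{n+m-1}|, & \text{otherwise (i.e. } \lambda<0 \text{ or } \lambda>\tfrac{2A_{n+m-1}}{A_nA_m}),\end{cases}$$ where $A_n=\frac{1}{(n-1)!}\prod_{j=0}^{n-2}\big(2(1-\alpha)+j\big)$ for $n\ge2$. The second inequality is sharp: equality in it is attained by the function $f_1(z)=\dfrac{z}{(1-z)^{2(1-\alpha)}}$ and by its rotations.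
   Context: $\mathbb{D}$ is the open unit disc and $\mathcal{A}$ is the class of analytic functions on $\mathbb{D}$ of the form $f(z)=z+a_2z^2+a_3z^3+\cdots$. For real $\alpha<1$, $\mathcal{S}^*(\alpha)$ is the class of $f\in\mathcal{A}$ with $\operatorname{Re}\big(zf'(z)/f(z)\big)>\alpha$ on $\mathbb{D}$. $H\mathcal{S}^*(\alpha)$ is the closed convex hull of $\mathcal{S}^*(\alpha)$ (closure in the topology of uniform convergence on compact subsets of $\mathbb{D}$). Powers of $1-z$ are taken with the branch equal to $1$ at $z=0$. The rotations of $f\in\mathcal{A}$ are the functions $z\mapsto e^{-i\theta}f(e^{i\theta}z)$, $\theta\in\mathbb{R}$. *)

theory Defs
  imports "HOL-Analysis.Analysis" "HOL-Library.Function_Algebras"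
begin

text \<open>Functions with the pointwise operations form a real vector space, which makes
  \<^const>\<open>convex\<close> and \<open>convex hull\<close> available for families of functions.\<close>

instantiation "fun" :: (type, real_vector) real_vector
begin

definition scaleR_fun_def: "r *\<^sub>R f = (\<lambda>x. r *\<^sub>R f x)"

instance
  by standard (simp_all add: scaleR_fun_def fun_eq_iff scaleR_add_left scaleR_add_right)

end

lemma scaleR_fun_apply [simp]: "(r *\<^sub>R f) x = r *\<^sub>R f x"
  by (simp add: scaleR_fun_def)

abbreviation unit_disc :: "complex set" where
  "unit_disc \<equiv> ball 0 1"

text \<open>The topology of uniform convergence on compact subsets, on the space of functions
  holomorphic on \<open>D\<close>. Members of the space are total functions whose values outside \<open>D\<close>
  are arbitrary; neither the topology nor the classes below look at those values.\<close>

definition open_ucc :: "complex set \<Rightarrow> (complex \<Rightarrow> complex) set \<Rightarrow> bool" where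
  "open_ucc D U \<longleftrightarrow> U \<subseteq> {f. f holomorphic_on D} \<and>
     (\<forall>f\<in>U. \<exists>K e. compact K \<and> K \<subseteq> D \<and> e > 0 \<and>
        {g. g holomorphic_on D \<and> (\<forall>z\<in>K. dist (g z) (f z) < e)} \<subseteq> U)"

definition ucc_topology :: "complex set \<Rightarrow> (complex \<Rightarrow> complex) topology" where
  "ucc_topology D = topology (open_ucc D)"

lemma istopology_open_ucc: "istopology (open_ucc D)"
  unfolding istopology_def
proof (intro conjI allI impI)
  fix S T assume S: "open_ucc D S" and T: "open_ucc D T"
  show "open_ucc D (S \<inter> T)"
    unfolding open_ucc_def
  proof (intro conjI ballI)
    show "S \<inter> T \<subseteq> {f. f holomorphic_on D}" using S by (auto simp: open_ucc_def)
    fix f assume f: "f \<in> S \<inter> T"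
    obtain K e where K: "compact K" "K \<subseteq> D" "e > 0"
      "{g. g holomorphic_on D \<and> (\<forall>z\<in>K. dist (g z) (f z) < e)} \<subseteq> S"
      using S f unfolding open_ucc_def by blast
    obtain L d where L: "compact L" "L \<subseteq> D" "d > 0"
      "{g. g holomorphic_on D \<and> (\<forall>z\<in>L. dist (g z) (f z) < d)} \<subseteq> T"
      using T f unfolding open_ucc_def by blast
    have "compact (K \<union> L)" "K \<union> L \<subseteq> D" "min e d > 0"
      using K L by (auto intro: compact_Un)
    moreover have "{g. g holomorphic_on D \<and> (\<forall>z\<in>K \<union> L. dist (g z) (f z) < min e d)} \<subseteq> S \<inter> T"
      using K(4) L(4) by auto
    ultimately show "\<exists>K e. compact K \<and> K \<subseteq> D \<and> e > 0 \<and>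
        {g. g holomorphic_on D \<and> (\<forall>z\<in>K. dist (g z) (f z) < e)} \<subseteq> S \<inter> T" by blast
  qed
next
  fix \<K> assume K: "\<forall>S\<in>\<K>. open_ucc D S"
  show "open_ucc D (\<Union>\<K>)"
    unfolding open_ucc_def
  proof (intro conjI ballI)
    show "\<Union>\<K> \<subseteq> {f. f holomorphic_on D}" using K by (auto simp: open_ucc_def)
    fix f assume "f \<in> \<Union>\<K>"
    then obtain S where S: "S \<in> \<K>" "f \<in> S" by blast
    have "open_ucc D S" using K S(1) by blast
    then have "\<exists>C e. compact C \<and> C \<subseteq> D \<and> e > 0 \<and>
        {g. g holomorphic_on D \<and> (\<forall>z\<in>C. dist (g z) (f z) < e)} \<subseteq> S"
      using S(2) unfolding open_ucc_def by (elim conjE) (erule (1) bspec)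
    moreover have "S \<subseteq> \<Union>\<K>" using S(1) by (rule Union_upper)
    ultimately show "\<exists>C e. compact C \<and> C \<subseteq> D \<and> e > 0 \<and>
        {g. g holomorphic_on D \<and> (\<forall>z\<in>C. dist (g z) (f z) < e)} \<subseteq> \<Union>\<K>"
      by (elim exE conjE, intro exI conjI) (assumption, assumption, assumption, rule order_trans)
  qed
qed

lemma openin_ucc_topology: "openin (ucc_topology D) U \<longleftrightarrow> open_ucc D U"
  by (simp add: ucc_topology_def istopology_open_ucc)

lemma topspace_ucc_topology: "topspace (ucc_topology D) = {f. f holomorphic_on D}"
proof -
  have "open_ucc D {f. f holomorphic_on D}"
    by (auto simp: open_ucc_def intro!: exI[of _ "{}"] exI[of _ "1::real"])
  then have "{f. f holomorphic_on D} \<subseteq> topspace (ucc_topology D)"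
    by (simp add: openin_subset openin_ucc_topology)
  moreover have "open_ucc D (topspace (ucc_topology D))"
    by (simp flip: openin_ucc_topology)
  ultimately show ?thesis
    by (auto simp: open_ucc_def)
qed

lemma in_closure_of_ucc_topology:
  "f \<in> ucc_topology D closure_of S \<longleftrightarrow> f holomorphic_on D \<and>
     (\<forall>K e. compact K \<and> K \<subseteq> D \<and> e > 0 \<longrightarrow>
        (\<exists>g\<in>S. g holomorphic_on D \<and> (\<forall>z\<in>K. dist (g z) (f z) < e)))"
proof (intro iffI conjI allI impI)
  assume f: "f \<in> ucc_topology D closure_of S"
  then show hol: "f holomorphic_on D"
    using topspace_ucc_topology by (auto simp: in_closure_of)
  fix K and e :: real assume K: "compact K \<and> K \<subseteq> D \<and> e > 0"
  define U where "U = {g. g holomorphic_on D \<and> (\<exists>d<e. \<forall>z\<in>K. dist (g z) (f z) \<le> d)}"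
  have "open_ucc D U"
    unfolding open_ucc_def
  proof (intro conjI ballI)
    show "U \<subseteq> {f. f holomorphic_on D}" by (auto simp: U_def)
    fix h assume "h \<in> U"
    then obtain d where d: "d < e" "\<And>z. z \<in> K \<Longrightarrow> dist (h z) (f z) \<le> d"
      by (auto simp: U_def)
    have "{g. g holomorphic_on D \<and> (\<forall>z\<in>K. dist (g z) (h z) < (e - d) / 2)} \<subseteq> U"
    proof (rule subsetI)
      fix g assume g: "g \<in> {g. g holomorphic_on D \<and> (\<forall>z\<in>K. dist (g z) (h z) < (e - d) / 2)}"
      have "dist (g z) (f z) \<le> (e + d) / 2" if "z \<in> K" for z
      proof -
        have "dist (g z) (f z) \<le> dist (g z) (h z) + dist (h z) (f z)"
          by (rule dist_triangle)
        also have "\<dots> \<le> (e - d) / 2 + d" using g d(2)[OF that] that by (intro add_mono) (auto intro: less_imp_le)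
        finally show ?thesis by (simp add: field_simps)
      qed
      moreover have "(e + d) / 2 < e" using d by simp
      ultimately show "g \<in> U" using g unfolding U_def by blast
    qed
    moreover have "compact K" "K \<subseteq> D" "(e - d) / 2 > 0" using K d(1) by auto
    ultimately show "\<exists>K e. compact K \<and> K \<subseteq> D \<and> e > 0 \<and>
        {g. g holomorphic_on D \<and> (\<forall>z\<in>K. dist (g z) (h z) < e)} \<subseteq> U"
      by blast
  qed
  moreover have "f \<in> U" using hol K by (auto simp: U_def intro!: exI[of _ 0])
  ultimately obtain g where "g \<in> S" "g \<in> U"
    using f by (auto simp: in_closure_of openin_ucc_topology)
  then show "\<exists>g\<in>S. g holomorphic_on D \<and> (\<forall>z\<in>K. dist (g z) (f z) < e)"
    by (force simp: U_def)
next
  assume *: "f holomorphic_on D \<and> (\<forall>K e. compact K \<and> K \<subseteq> D \<and> e > 0 \<longrightarrow>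
        (\<exists>g\<in>S. g holomorphic_on D \<and> (\<forall>z\<in>K. dist (g z) (f z) < e)))"
  show "f \<in> ucc_topology D closure_of S"
    unfolding in_closure_of
  proof (intro conjI allI impI)
    show "f \<in> topspace (ucc_topology D)" using * by (simp add: topspace_ucc_topology)
    fix T assume "f \<in> T \<and> openin (ucc_topology D) T"
    then obtain K e where "compact K" "K \<subseteq> D" "e > 0"
      "{g. g holomorphic_on D \<and> (\<forall>z\<in>K. dist (g z) (f z) < e)} \<subseteq> T"
      by (auto simp: openin_ucc_topology open_ucc_def)
    with * show "\<exists>y. y \<in> S \<and> y \<in> T" by blast
  qed
qed

text \<open>\<open>normalized_expansion f a\<close>: \<open>f(z) = z + a\<^sub>2 z\<^sup>2 + a\<^sub>3 z\<^sup>3 + \<dots>\<close> on the unit disc.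
  The values \<open>a 0\<close> and \<open>a 1\<close> play no role.\<close>

definition normalized_expansion :: "(complex \<Rightarrow> complex) \<Rightarrow> (nat \<Rightarrow> complex) \<Rightarrow> bool" where
  "normalized_expansion f a \<longleftrightarrow>
     (\<forall>z\<in>unit_disc. (\<lambda>n. a (n + 2) * z ^ (n + 2)) sums (f z - z))"

definition normalized_analytic :: "(complex \<Rightarrow> complex) set" where
  "normalized_analytic = {f. f holomorphic_on unit_disc \<and> (\<exists>a. normalized_expansion f a)}"

text \<open>The quotient \<open>z f'(z) / f(z)\<close> has a removable singularity with value \<open>1 > \<alpha>\<close> at the
  origin, so only \<open>z \<noteq> 0\<close> is constrained. That the quotient is defined there is
  stated explicitly, since division by zero yields \<open>0\<close>, which could exceed \<open>\<alpha>\<close>.\<close>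

definition starlike_of_order :: "real \<Rightarrow> (complex \<Rightarrow> complex) set" where
  "starlike_of_order \<alpha> = {f \<in> normalized_analytic.
     \<forall>z\<in>unit_disc - {0}. f z \<noteq> 0 \<and> Re (z * deriv f z / f z) > \<alpha>}"

definition closed_hull_starlike :: "real \<Rightarrow> (complex \<Rightarrow> complex) set" where
  "closed_hull_starlike \<alpha> = ucc_topology unit_disc closure_of (convex hull starlike_of_order \<alpha>)"

text \<open>The formula is meant for \<open>n \<ge> 2\<close> only (natural subtraction truncates).\<close>

definition A_coeff :: "real \<Rightarrow> nat \<Rightarrow> real" where
  "A_coeff \<alpha> n = (1 / fact (n - 1)) * (\<Prod>j = 0..n - 2. 2 * (1 - \<alpha>) + real j)"

text \<open>On the unit disc \<open>Re (1 - z) > 0\<close>, so the principal power is the holomorphic branch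
  with value \<open>1\<close> at \<open>z = 0\<close>.\<close>

definition starlike_extremal :: "real \<Rightarrow> complex \<Rightarrow> complex" where
  "starlike_extremal \<alpha> z = z / (1 - z) powr complex_of_real (2 * (1 - \<alpha>))"

definition rotation :: "real \<Rightarrow> (complex \<Rightarrow> complex) \<Rightarrow> complex \<Rightarrow> complex" where
  "rotation \<theta> f z = exp (- (\<i> * complex_of_real \<theta>)) * f (exp (\<i> * complex_of_real \<theta>) * z)"

lemma rotation_0 [simp]: "rotation 0 f = f"
  by (simp add: rotation_def fun_eq_iff)

end

theory Submission
  imports Defs "HOL-Complex_Analysis.Complex_Analysis"
begin

text \<open>
  Put \<open>p = 2 (1 - \<alpha>)\<close> and write \<open>a\<^sub>n\<^sub>+\<^sub>1 = ((p)\<^sub>n / n!) c\<^sub>n\<close>, where \<open>(p)\<^sub>n / n!\<close> is the \<open>n\<close>-th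
  coefficient of \<open>(1 - z)\<^bsup>-p\<^esup>\<close> and equals \<open>A\<^sub>n\<^sub>+\<^sub>1\<close> for \<open>n \<ge> 1\<close>. For \<open>f\<close> in the closed convex hull of
  the starlike functions the sequence \<open>c\<close> is a sequence of moments \<open>\<integral> w\<^sup>n d\<nu>(w)\<close> of a probability
  measure on the closed unit disc. This is the theorem of Brannan, Clunie and Kirwan that the hull
  consists of mixtures of the functions \<open>z / (1 - x z)\<^bsup>p\<^esup>\<close>. No measure is constructed here: being a
  moment sequence is expressed dually, through the finitely supported linear functionals that are
  nonnegative at all sequences \<open>(w\<^sup>n)\<close> with \<open>\<bar>w\<bar> \<le> 1\<close>. In this form the property visibly passes
  to convex combinations and to limits, so that only starlike functions have to be treated.

  For a starlike \<open>f\<close>, let \<open>g = f(z)/z\<close>. Then \<open>1 + (2/p) z g'/g\<close> has nonnegative real part and value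
  \<open>1\<close> at the origin, so half of its Taylor coefficients are moments \<open>m\<^sub>n\<close>
  (\<open>disc_moments_Caratheodory\<close>). Heuristically \<open>g = \<Prod> (1 - x\<^sub>j z)\<^bsup>-p\<^sub>j\<^esup>\<close> with \<open>\<Sum> p\<^sub>j = p\<close>, and such a product
  is an average of the functions \<open>(1 - w z)\<^bsup>-p\<^esup>\<close> with \<open>w\<close> a convex combination of the \<open>x\<^sub>j\<close>, the
  weights being Dirichlet distributed. For two factors this is the Beta integral
  (\<open>kernel_hull_mult\<close>). To reach \<open>g\<close> itself, approximate it by the \<open>M\<close>-th power of
  \<open>\<Sum> ((p/M)\<^sub>n / n!) m\<^sub>n z\<^sup>n\<close>, the \<open>m\<close>-average of \<open>(1 - x z)\<^bsup>-p/M\<^esup>\<close> (\<open>kernel_hull_generator\<close>).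

  The coefficient inequality becomes \<open>\<bar>L c\<^sub>j c\<^sub>k - c\<^sub>j\<^sub>+\<^sub>k\<bar> \<le> max 1 \<bar>L - 1\<bar>\<close> for real \<open>L\<close>. By the
  triangle inequality it reduces to \<open>\<bar>c\<^sub>k\<bar> \<le> 1\<close> and to the case \<open>L = 2\<close>, and the latter comes from testing
  \<open>c\<close> against a single nonnegative functional chosen in dependence on \<open>c\<^sub>k\<close>
  (\<open>disc_moments_Zalcman_2\<close>).
\<close>

section \<open>Moment sequences of the closed disc\<close>

text \<open>By duality, these are the members of the closed convex cone generated by the sequences
  \<open>(w\<^sup>n)\<close> with \<open>\<bar>w\<bar> \<le> 1\<close>, that is, the moment sequences of finite positive measures on the closed
  disc. The measure is a probability measure when \<open>c 0 = 1\<close>.\<close>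

definition disc_moments :: "(nat \<Rightarrow> complex) \<Rightarrow> bool" where
  "disc_moments c \<longleftrightarrow>
     (\<forall>N \<phi>. (\<forall>w. norm w \<le> 1 \<longrightarrow> 0 \<le> Re (\<Sum>n\<le>N. \<phi> n * w ^ n)) \<longrightarrow>
        0 \<le> Re (\<Sum>n\<le>N. \<phi> n * c n))"

text \<open>Since \<open>(p)\<^sub>n / n!\<close> is the \<open>n\<close>-th coefficient of \<open>(1 - z)\<^bsup>-p\<^esup>\<close>, this is the closed convex cone
  generated by the kernels \<open>(1 - w z)\<^bsup>-p\<^esup>\<close> with \<open>\<bar>w\<bar> \<le> 1\<close>, for \<open>p > 0\<close>.\<close>

definition kernel_hull :: "real \<Rightarrow> complex fps \<Rightarrow> bool" where
  "kernel_hull p g \<longleftrightarrow> disc_moments (\<lambda>n. fps_nth g n * fact n / of_real (pochhammer p n))"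

lemma disc_momentsD:
  assumes "disc_moments c" "\<And>w. norm w \<le> 1 \<Longrightarrow> 0 \<le> Re (\<Sum>n\<le>N. \<phi> n * w ^ n)"
  shows "0 \<le> Re (\<Sum>n\<le>N. \<phi> n * c n)"
  using assms unfolding disc_moments_def by blast

lemma disc_moments_limit:
  assumes "\<And>M. disc_moments (C M)" "\<And>n. (\<lambda>M. C M n) \<longlonglongrightarrow> c n"
  shows "disc_moments c"
  unfolding disc_moments_def
proof (intro allI impI)
  fix N \<phi>
  assume "\<forall>w. norm w \<le> 1 \<longrightarrow> 0 \<le> Re (\<Sum>n\<le>N. \<phi> n * w ^ n)"
  then have "0 \<le> Re (\<Sum>n\<le>N. \<phi> n * C M n)" for M
    using disc_momentsD[OF assms(1)] by blast
  moreover have "(\<lambda>M. Re (\<Sum>n\<le>N. \<phi> n * C M n)) \<longlonglongrightarrow> Re (\<Sum>n\<le>N. \<phi> n * c n)"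
    by (intro tendsto_intros assms(2))
  ultimately show "0 \<le> Re (\<Sum>n\<le>N. \<phi> n * c n)"
    by (intro LIMSEQ_le_const) auto
qed

lemma sum_triangle_square:
  fixes F :: "nat \<Rightarrow> nat \<Rightarrow> 'a :: comm_monoid_add"
  shows "(\<Sum>n\<le>N. \<Sum>i\<le>n. F i (n - i)) = (\<Sum>i\<le>N. \<Sum>j\<le>N. if i + j \<le> N then F i j else 0)"
proof -
  have "(\<Sum>i\<le>N. \<Sum>j\<le>N. if i + j \<le> N then F i j else 0) = (\<Sum>i\<le>N. \<Sum>j\<in>{j \<in> {..N}. i + j \<le> N}. F i j)"
    by (simp only: sum.inter_filter[OF finite_atMost])
  also have "\<dots> = (\<Sum>(i, j) | i + j \<le> N. F i j)"
    by (subst sum.Sigma) (auto intro!: sum.cong)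
  finally show ?thesis
    by (simp add: sum.triangle_reindex_eq)
qed

text \<open>If \<open>c\<close> and \<open>e\<close> are the moments of independent random points \<open>W\<close> and \<open>V\<close> of the disc, the
  sequence below consists of the moments of \<open>t W + (1 - t) V\<close>, which again lies in the disc. Dually,
  a nonnegative functional evaluated at \<open>t w + (1 - t) v\<close> is nonnegative in \<open>w\<close> and \<open>v\<close> jointly, and
  the powers of \<open>v\<close> and of \<open>w\<close> can be replaced by \<open>e\<close> and \<open>c\<close> one after the other.\<close>

lemma disc_moments_binomial_mix:
  assumes c: "disc_moments c" and e: "disc_moments e" and t: "0 \<le> t" "t \<le> 1"
  shows "disc_moments (\<lambda>n. \<Sum>i\<le>n. of_nat (n choose i) * of_real (t ^ i * (1 - t) ^ (n - i)) * c i * e (n - i))"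
  unfolding disc_moments_def
proof (intro allI impI)
  fix N and \<phi> :: "nat \<Rightarrow> complex"
  assume pos: "\<forall>w. norm w \<le> 1 \<longrightarrow> 0 \<le> Re (\<Sum>n\<le>N. \<phi> n * w ^ n)"
  define K where "K i j = (if i + j \<le> N then
     \<phi> (i + j) * of_nat (i + j choose i) * of_real (t ^ i * (1 - t) ^ j) else 0)" for i j
  have square: "(\<Sum>n\<le>N. \<phi> n * (\<Sum>i\<le>n. of_nat (n choose i) * of_real (t ^ i * (1 - t) ^ (n - i)) * x i * y (n - i)))
      = (\<Sum>i\<le>N. \<Sum>j\<le>N. K i j * x i * y j)" for x y :: "nat \<Rightarrow> complex"
  proof -
    define F where "F i j = \<phi> (i + j) * of_nat (i + j choose i) * of_real (t ^ i * (1 - t) ^ j) * x i * y j" for i j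
    have "(\<Sum>n\<le>N. \<phi> n * (\<Sum>i\<le>n. of_nat (n choose i) * of_real (t ^ i * (1 - t) ^ (n - i)) * x i * y (n - i)))
      = (\<Sum>n\<le>N. \<Sum>i\<le>n. F i (n - i))"
      by (simp add: F_def sum_distrib_left mult_ac)
    also have "\<dots> = (\<Sum>i\<le>N. \<Sum>j\<le>N. K i j * x i * y j)"
      unfolding sum_triangle_square by (intro sum.cong refl) (simp add: K_def F_def)
    finally show ?thesis .
  qed
  \<comment> \<open>The bilinear form given by \<open>K\<close> is now tested on \<open>(w\<^sup>i, v\<^sup>j)\<close>, then on \<open>(w\<^sup>i, e j)\<close>, then on \<open>(c i, e j)\<close>.\<close>
  have disc: "0 \<le> Re (\<Sum>i\<le>N. \<Sum>j\<le>N. K i j * w ^ i * v ^ j)" if "norm w \<le> 1" "norm v \<le> 1" for w v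
  proof -
    have "norm (of_real t * w + of_real (1 - t) * v) \<le> norm (of_real t * w) + norm (of_real (1 - t) * v)"
      by (rule norm_triangle_ineq)
    also have "\<dots> \<le> t * 1 + (1 - t) * 1"
      unfolding norm_mult norm_of_real using t that by (intro add_mono mult_mono) auto
    finally have "norm (of_real t * w + of_real (1 - t) * v) \<le> 1" by simp
    then have "0 \<le> Re (\<Sum>n\<le>N. \<phi> n * (of_real t * w + of_real (1 - t) * v) ^ n)"
      using pos by blast
    also have "(\<Sum>n\<le>N. \<phi> n * (of_real t * w + of_real (1 - t) * v) ^ n)
       = (\<Sum>n\<le>N. \<phi> n * (\<Sum>i\<le>n. of_nat (n choose i) * of_real (t ^ i * (1 - t) ^ (n - i)) * w ^ i * v ^ (n - i)))"
      by (simp add: binomial_ring power_mult_distrib mult_ac)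
    finally show ?thesis unfolding square .
  qed
  have half: "0 \<le> Re (\<Sum>i\<le>N. \<Sum>j\<le>N. K i j * w ^ i * e j)" if w: "norm w \<le> 1" for w
  proof -
    have "0 \<le> Re (\<Sum>j\<le>N. (\<Sum>i\<le>N. K i j * w ^ i) * e j)"
    proof (rule disc_momentsD[OF e])
      fix v :: complex assume "norm v \<le> 1"
      then have "0 \<le> Re (\<Sum>j\<le>N. \<Sum>i\<le>N. K i j * w ^ i * v ^ j)"
        using disc[OF w] by (subst sum.swap)
      then show "0 \<le> Re (\<Sum>j\<le>N. (\<Sum>i\<le>N. K i j * w ^ i) * v ^ j)"
        by (simp add: sum_distrib_right del: Re_sum)
    qed
    then have "0 \<le> Re (\<Sum>j\<le>N. \<Sum>i\<le>N. K i j * w ^ i * e j)"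
      by (simp add: sum_distrib_right del: Re_sum)
    then show ?thesis by (subst sum.swap)
  qed
  have "0 \<le> Re (\<Sum>i\<le>N. (\<Sum>j\<le>N. K i j * e j) * c i)"
  proof (rule disc_momentsD[OF c])
    fix w :: complex assume "norm w \<le> 1"
    from half[OF this] show "0 \<le> Re (\<Sum>i\<le>N. (\<Sum>j\<le>N. K i j * e j) * w ^ i)"
      by (simp add: sum_distrib_left sum_distrib_right mult_ac del: Re_sum)
  qed
  then show "0 \<le> Re (\<Sum>n\<le>N. \<phi> n *
       (\<Sum>i\<le>n. of_nat (n choose i) * of_real (t ^ i * (1 - t) ^ (n - i)) * c i * e (n - i)))"
    unfolding square by (simp add: sum_distrib_left sum_distrib_right mult_ac del: Re_sum)
qed

lemma Beta_moments:
  fixes p q :: real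
  assumes "p > 0" "q > 0"
  shows "((\<lambda>t. t powr (p - 1) * (1 - t) powr (q - 1) * (t ^ i * (1 - t) ^ j)) has_integral
          Beta p q * (pochhammer p i * pochhammer q j / pochhammer (p + q) (i + j))) {0..1}"
proof -
  have "((\<lambda>t. t powr (p + i - 1) * (1 - t) powr (q + j - 1)) has_integral Beta (p + i) (q + j)) {0..1}"
    using has_integral_Beta_real[of "p + i" "q + j"] assms by simp
  moreover have "Beta (p + i) (q + j) = Beta p q * (pochhammer p i * pochhammer q j / pochhammer (p + q) (i + j))"
  proof -
    have "Gamma (x + real k) = pochhammer x k * Gamma x" if "x > 0" for x k
    proof -
      have "x \<notin> \<int>\<^sub>\<le>\<^sub>0" using that nonpos_Ints_nonpos[of x] by linarith
      then show ?thesis using Gamma_real_pos[OF that] by (simp add: pochhammer_Gamma)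
    qed
    from this[of p i] this[of q j] this[of "p + q" "i + j"] assms
    show ?thesis by (simp add: Beta_def add_ac mult_ac)
  qed
  moreover have "t powr (p + i - 1) * (1 - t) powr (q + j - 1) =
       t powr (p - 1) * (1 - t) powr (q - 1) * (t ^ i * (1 - t) ^ j)" if "t \<in> {0..1}" for t
  proof -
    have "x powr (s + real k - 1) = x powr (s - 1) * x ^ k" if "x \<ge> 0" for x s :: real and k
      using that by (cases "x = 0") (simp_all add: powr_add powr_diff powr_realpow field_simps)
    from this[of t p i] this[of "1 - t" q j] that show ?thesis by simp
  qed
  ultimately show ?thesis
    by (metis (no_types, lifting) has_integral_cong)
qed

text \<open>The expectation of \<open>(1 - (T x + (1 - T) y) z)\<^bsup>-(p + q)\<^esup>\<close> for a \<open>Beta(p, q)\<close>-distributed \<open>T\<close> is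
  \<open>(1 - x z)\<^bsup>-p\<^esup> (1 - y z)\<^bsup>-q\<^esup>\<close>. On normalized coefficients, the product of two series is
  accordingly the Beta average over \<open>t\<close> of the mixtures of \<open>disc_moments_binomial_mix\<close>.\<close>

lemma kernel_hull_mult:
  assumes p: "p > 0" and q: "q > 0" and g: "kernel_hull p g" and h: "kernel_hull q h"
  shows "kernel_hull (p + q) (g * h)"
  unfolding kernel_hull_def disc_moments_def
proof (intro allI impI)
  fix N and \<phi> :: "nat \<Rightarrow> complex"
  assume pos: "\<forall>w. norm w \<le> 1 \<longrightarrow> 0 \<le> Re (\<Sum>n\<le>N. \<phi> n * w ^ n)"
  define c where "c n = fps_nth g n * fact n / of_real (pochhammer p n)" for n
  define e where "e n = fps_nth h n * fact n / of_real (pochhammer q n)" for n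
  \<comment> \<open>\<open>\<rho>\<close> is the unnormalized Beta density, \<open>I n i\<close> the mean of \<open>t\<^sup>i (1 - t)\<^bsup>n - i\<^esup>\<close>.\<close>
  define \<rho> where "\<rho> t = t powr (p - 1) * (1 - t) powr (q - 1)" for t :: real
  define I where "I n i = pochhammer p i * pochhammer q (n - i) / pochhammer (p + q) n" for n i :: nat
  have nz: "pochhammer p n \<noteq> 0" "pochhammer q n \<noteq> 0" "pochhammer (p + q) n \<noteq> 0" for n
    using p q by (simp_all add: pochhammer_pos less_imp_neq[symmetric])
  have c_nth: "fps_nth g n = c n * of_real (pochhammer p n) / fact n"
    and e_nth: "fps_nth h n = e n * of_real (pochhammer q n) / fact n" for n
    using nz by (simp_all add: c_def e_def)
  have coeff: "fps_nth (g * h) n * fact n / of_real (pochhammer (p + q) n) =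
      (\<Sum>i\<le>n. of_nat (n choose i) * of_real (I n i) * c i * e (n - i))" for n
  proof -
    have "fps_nth (g * h) n * fact n / of_real (pochhammer (p + q) n)
      = (\<Sum>i\<le>n. fps_nth g i * fps_nth h (n - i) * fact n / of_real (pochhammer (p + q) n))"
      by (simp add: fps_mult_nth sum_distrib_right sum_divide_distrib atLeast0AtMost)
    also have "\<dots> = (\<Sum>i\<le>n. of_nat (n choose i) * of_real (I n i) * c i * e (n - i))"
      using nz by (intro sum.cong refl) (simp add: c_nth e_nth I_def binomial_fact field_simps)
    finally show ?thesis .
  qed
  have "((\<lambda>t. \<Sum>n\<le>N. \<Sum>i\<le>n. Re (\<phi> n * of_nat (n choose i) * c i * e (n - i)) *
            (\<rho> t * (t ^ i * (1 - t) ^ (n - i)))) has_integral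
         (\<Sum>n\<le>N. \<Sum>i\<le>n. Re (\<phi> n * of_nat (n choose i) * c i * e (n - i)) * (Beta p q * I n i))) {0..1}"
  proof (intro has_integral_sum has_integral_mult_right)
    fix n i :: nat assume "i \<in> {..n}"
    then show "((\<lambda>t. \<rho> t * (t ^ i * (1 - t) ^ (n - i))) has_integral Beta p q * I n i) {0..1}"
      using Beta_moments[OF p q, of i "n - i"] by (simp add: \<rho>_def I_def)
  qed auto
  moreover have "(\<Sum>n\<le>N. \<Sum>i\<le>n. Re (\<phi> n * of_nat (n choose i) * c i * e (n - i)) * (\<rho> t * (t ^ i * (1 - t) ^ (n - i))))
      = \<rho> t * Re (\<Sum>n\<le>N. \<phi> n * (\<Sum>i\<le>n. of_nat (n choose i) * of_real (t ^ i * (1 - t) ^ (n - i)) * c i * e (n - i)))"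
    (is "?L t = ?R t") for t
  proof -
    have "?R t = (\<Sum>n\<le>N. \<Sum>i\<le>n. \<rho> t * Re (of_real (t ^ i * (1 - t) ^ (n - i)) * (\<phi> n * of_nat (n choose i) * c i * e (n - i))))"
      by (simp add: sum_distrib_left mult_ac del: of_real_mult of_real_power)
    also have "\<dots> = ?L t"
      by (intro sum.cong refl) (simp add: algebra_simps)
    finally show ?thesis by simp
  qed
  moreover have "?R t \<ge> 0" if "t \<in> {0..1}" for t
    using that pos disc_momentsD[OF disc_moments_binomial_mix[OF g[unfolded kernel_hull_def] h[unfolded kernel_hull_def]], of t \<phi> N]
    unfolding c_def e_def by (intro mult_nonneg_nonneg) (auto simp: \<rho>_def)
  ultimately have "0 \<le> (\<Sum>n\<le>N. \<Sum>i\<le>n. Re (\<phi> n * of_nat (n choose i) * c i * e (n - i)) * (Beta p q * I n i))"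
    by (metis (no_types, lifting) has_integral_nonneg)
  also have "\<dots> = (\<Sum>n\<le>N. \<Sum>i\<le>n. Beta p q * Re (of_real (I n i) * (\<phi> n * of_nat (n choose i) * c i * e (n - i))))"
    by (intro sum.cong refl) (simp add: algebra_simps)
  also have "\<dots> = Beta p q * Re (\<Sum>n\<le>N. \<phi> n * (fps_nth (g * h) n * fact n / of_real (pochhammer (p + q) n)))"
    unfolding coeff by (simp add: sum_distrib_left mult_ac)
  finally have "0 \<le> Beta p q * Re (\<Sum>n\<le>N. \<phi> n * (fps_nth (g * h) n * fact n / of_real (pochhammer (p + q) n)))" .
  moreover have "Beta p q > 0"
    using p q by (simp add: Beta_def)
  ultimately show "0 \<le> Re (\<Sum>n\<le>N. \<phi> n * (fps_nth (g * h) n * fact n / of_real (pochhammer (p + q) n)))"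
    by (simp only: zero_le_mult_iff) linarith
qed

lemma kernel_hull_power:
  assumes "q > 0" "kernel_hull q g"
  shows "kernel_hull (real (Suc k) * q) (g ^ Suc k)"
proof (induction k)
  case 0
  then show ?case using assms by simp
next
  case (Suc k)
  have "kernel_hull (q + real (Suc k) * q) (g * g ^ Suc k)"
    using assms Suc by (intro kernel_hull_mult) auto
  then show ?case by (simp add: algebra_simps)
qed

section \<open>Functions of positive real part\<close>

text \<open>Cauchy's formula over a parametrized circle. As an integral over a real interval, unlike the
  contour integral, it can be combined with real parts and pointwise inequalities.\<close>

lemma circle_mean_coeff:
  assumes f: "f holomorphic_on ball 0 1" and r: "0 < r" "r < 1"
  shows "((\<lambda>x. f (of_real r * exp (2 * of_real pi * \<i> * of_real x)) /
            (of_real r * exp (2 * of_real pi * \<i> * of_real x)) ^ k)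
          has_integral (deriv ^^ k) f 0 / fact k) {0..1}"
proof -
  let ?e = "\<lambda>x::real. exp (2 * of_real pi * \<i> * of_real x) :: complex"
  have cont: "continuous_on (cball 0 r) f"
    using f r by (intro holomorphic_on_imp_continuous_on) (auto elim: holomorphic_on_subset)
  have hol: "f holomorphic_on ball 0 r"
    using f r by (auto elim: holomorphic_on_subset)
  have "((\<lambda>u. f u / (u - 0) ^ Suc k) has_contour_integral
           2 * pi * \<i> / fact k * (deriv ^^ k) f 0) (circlepath 0 r)"
    using r by (intro Cauchy_has_contour_integral_higher_derivative_circlepath cont hol) auto
  then have "((\<lambda>x. f (circlepath 0 r x) / (circlepath 0 r x) ^ Suc k *
        vector_derivative (circlepath 0 r) (at x within {0..1}))
      has_integral 2 * pi * \<i> / fact k * (deriv ^^ k) f 0) {0..1}"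
    by (simp add: has_contour_integral_def)
  then have "((\<lambda>x. 1 / (2 * pi * \<i>) * (f (circlepath 0 r x) / (circlepath 0 r x) ^ Suc k *
        vector_derivative (circlepath 0 r) (at x within {0..1})))
      has_integral 1 / (2 * pi * \<i>) * (2 * pi * \<i> / fact k * (deriv ^^ k) f 0)) {0..1}"
    by (rule has_integral_mult_right)
  moreover have "1 / (2 * pi * \<i>) * (f (circlepath 0 r x) / (circlepath 0 r x) ^ Suc k *
        vector_derivative (circlepath 0 r) (at x within {0..1})) =
        f (of_real r * ?e x) / (of_real r * ?e x) ^ k" if "x \<in> {0..1}" for x
    using that r by (simp add: vector_derivative_circlepath01) (simp add: circlepath field_simps)
  ultimately show ?thesis
    by (subst has_integral_cong[where g = "\<lambda>x. 1 / (2 * pi * \<i>) * (f (circlepath 0 r x) / (circlepath 0 r x) ^ Suc k *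
        vector_derivative (circlepath 0 r) (at x within {0..1}))"]) auto
qed

text \<open>By Herglotz's formula these are the moments of the boundary measure of \<open>Re P\<close>, reflected in
  the real axis. For the dilation \<open>P(r z)\<close> with \<open>r < 1\<close> its density is \<open>Re P(r e)\<close>, and the mean of
  \<open>Re P(r e) \<cdot> Re (\<Sum> \<phi>\<^sub>n e\<^bsup>-n\<^esup>)\<close> is nonnegative; the orthogonality of the powers of \<open>e\<close> evaluates it
  as the functional \<open>\<phi>\<close> at the sequence \<open>(r\<^sup>n c\<^sub>n)\<close>. Then let \<open>r \<rightarrow> 1\<close>.\<close>

lemma disc_moments_Caratheodory:
  assumes P: "P holomorphic_on ball 0 1" and P0: "P 0 = 1"
    and pos: "\<And>z. z \<in> ball 0 1 \<Longrightarrow> 0 \<le> Re (P z)"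
  shows "disc_moments (\<lambda>n. if n = 0 then 1 else (deriv ^^ n) P 0 / fact n / 2)"
    (is "disc_moments ?c")
  unfolding disc_moments_def
proof (intro allI impI)
  fix N and \<phi> :: "nat \<Rightarrow> complex"
  assume \<phi>: "\<forall>w. norm w \<le> 1 \<longrightarrow> 0 \<le> Re (\<Sum>n\<le>N. \<phi> n * w ^ n)"
  have inner: "0 \<le> Re (\<Sum>n\<le>N. \<phi> n * (of_real r ^ n * ?c n))" if r: "0 < r" "r < 1" for r
  proof -
    define e where "e x = exp (2 * of_real pi * \<i> * of_real x)" for x :: real
    have e: "norm (e x) = 1" "e x \<noteq> 0" "cnj (e x) = 1 / e x" for x
    proof -
      show "norm (e x) = 1" "e x \<noteq> 0" by (simp_all add: e_def)
      show "cnj (e x) = 1 / e x"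
        using divide_conv_cnj[of "e x" 1] by (simp add: e_def)
    qed
    have neg: "((\<lambda>x. P (of_real r * e x) * (\<phi> n * cnj (e x) ^ n))
        has_integral \<phi> n * (of_real r ^ n * ((deriv ^^ n) P 0 / fact n))) {0..1}" for n
    proof -
      have "((\<lambda>x. \<phi> n * (of_real r ^ n * (P (of_real r * e x) / (of_real r * e x) ^ n)))
        has_integral \<phi> n * (of_real r ^ n * ((deriv ^^ n) P 0 / fact n))) {0..1}"
        unfolding e_def using circle_mean_coeff[OF P r] by (intro has_integral_mult_right)
      then show ?thesis using r by (simp add: e field_simps power_mult_distrib)
    qed
    have "((\<lambda>x. P (of_real r * e x) * (cnj (\<phi> n) * e x ^ n))
        has_integral (if n = 0 then cnj (\<phi> 0) else 0)) {0..1}" for n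
    proof -
      \<comment> \<open>A power of positive exponent times \<open>P\<close> has mean \<open>0\<close>, as it vanishes at the origin.\<close>
      have "(\<lambda>z. z ^ n * P z) holomorphic_on ball 0 1"
        using P by (intro holomorphic_intros)
      from circle_mean_coeff[OF this r, of 0]
      have "((\<lambda>x. (cnj (\<phi> n) / of_real r ^ n) * ((of_real r * e x) ^ n * P (of_real r * e x)))
        has_integral (cnj (\<phi> n) / of_real r ^ n) * (0 ^ n * P 0)) {0..1}"
        unfolding e_def by (intro has_integral_mult_right) simp
      then show ?thesis using r by (cases "n = 0") (simp_all add: P0 power_0_left field_simps power_mult_distrib)
    qed
    then have "((\<lambda>x. Re (\<Sum>n\<le>N. P (of_real r * e x) * (\<phi> n * cnj (e x) ^ n) +
           P (of_real r * e x) * (cnj (\<phi> n) * e x ^ n)))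
        has_integral Re (\<Sum>n\<le>N. \<phi> n * (of_real r ^ n * ((deriv ^^ n) P 0 / fact n)) +
            (if n = 0 then cnj (\<phi> 0) else 0))) {0..1}"
      using neg by (intro has_integral_Re has_integral_sum has_integral_add) auto
    moreover have "0 \<le> Re (\<Sum>n\<le>N. P (of_real r * e x) * (\<phi> n * cnj (e x) ^ n) +
           P (of_real r * e x) * (cnj (\<phi> n) * e x ^ n))" for x
    proof -
      define S where "S = (\<Sum>n\<le>N. \<phi> n * cnj (e x) ^ n)"
      have "(\<Sum>n\<le>N. P (of_real r * e x) * (\<phi> n * cnj (e x) ^ n) +
           P (of_real r * e x) * (cnj (\<phi> n) * e x ^ n)) = P (of_real r * e x) * (S + cnj S)"
        by (simp add: S_def sum.distrib sum_distrib_left distrib_left)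
      also have "Re \<dots> = 2 * (Re (P (of_real r * e x)) * Re S)"
        by (simp add: complex_add_cnj)
      also have "\<dots> \<ge> 0"
      proof -
        have "0 \<le> Re S"
          using \<phi>[rule_format, of "cnj (e x)"] e(1)[of x] unfolding S_def complex_mod_cnj by simp
        moreover have "0 \<le> Re (P (of_real r * e x))"
          using pos[of "of_real r * e x"] r e(1)[of x] by (simp add: norm_mult)
        ultimately show ?thesis by simp
      qed
      finally show ?thesis .
    qed
    ultimately have "0 \<le> Re (\<Sum>n\<le>N. \<phi> n * (of_real r ^ n * ((deriv ^^ n) P 0 / fact n)) +
            (if n = 0 then cnj (\<phi> 0) else 0))"
      by (rule has_integral_nonneg)
    also have "\<dots> = 2 * Re (\<Sum>n\<le>N. \<phi> n * (of_real r ^ n * ?c n))"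
      unfolding Re_sum sum_distrib_left
    proof (intro sum.cong refl)
      fix n
      define y where "y = (deriv ^^ n) P 0 / fact n"
      have "y = 1" if "n = 0" using that by (simp add: y_def P0)
      then show "Re (\<phi> n * (of_real r ^ n * ((deriv ^^ n) P 0 / fact n)) + (if n = 0 then cnj (\<phi> 0) else 0))
          = 2 * Re (\<phi> n * (of_real r ^ n * ?c n))"
        unfolding y_def[symmetric] by (cases "n = 0") simp_all
    qed
    finally show ?thesis by linarith
  qed
  have "((\<lambda>r. Re (\<Sum>n\<le>N. \<phi> n * (of_real r ^ n * ?c n))) \<longlongrightarrow>
         Re (\<Sum>n\<le>N. \<phi> n * (of_real 1 ^ n * ?c n))) (at_left 1)"
    by (intro tendsto_intros)
  moreover have "eventually (\<lambda>r. 0 \<le> Re (\<Sum>n\<le>N. \<phi> n * (of_real r ^ n * ?c n))) (at_left 1)"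
    using eventually_at_left_real[of 0 "1::real", OF zero_less_one]
    by (rule eventually_mono) (use inner in \<open>simp del: Re_sum\<close>)
  ultimately have "0 \<le> Re (\<Sum>n\<le>N. \<phi> n * (of_real 1 ^ n * ?c n))"
    by (intro tendsto_lowerbound[of _ _ "at_left (1::real)"]) auto
  then show "0 \<le> Re (\<Sum>n\<le>N. \<phi> n * ?c n)" by simp
qed

section \<open>Coefficients of functions in the closed hull\<close>

text \<open>The recursion says \<open>z b' = p (\<Sum>\<^sub>i\<^sub>\<ge>\<^sub>1 m\<^sub>i z\<^sup>i) b\<close>, that is, \<open>b = exp (p \<Sum>\<^sub>i\<^sub>\<ge>\<^sub>1 m\<^sub>i z\<^sup>i / i)\<close>, which for
  moments \<open>m\<close> of a measure \<open>\<mu>\<close> is \<open>exp (- p \<integral> log (1 - x z) d\<mu>(x))\<close>. For small \<open>q\<close> the exponential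
  with \<open>q\<close> in place of \<open>p\<close> agrees up to \<open>O(q\<^sup>2)\<close> with the average \<open>h\<close> of \<open>(1 - x z)\<^bsup>-q\<^esup>\<close>, which lies in
  the hull for \<open>q\<close> by definition. So with \<open>q = p / M\<close> the powers \<open>h\<^sup>M\<close>, which lie in the hull for
  \<open>p\<close>, converge to \<open>b\<close>. The convergence is read off from the differential equations, coefficient by
  coefficient, without logarithms. (The index \<open>M\<close> is shifted by one to avoid \<open>M = 0\<close>.)\<close>

lemma kernel_hull_generator:
  assumes p: "p > 0" and m: "disc_moments m" and m0: "m 0 = 1" and b0: "fps_nth b 0 = 1"
    and b: "\<And>n. n > 0 \<Longrightarrow> of_nat n * fps_nth b n = of_real p * (\<Sum>i=1..n. m i * fps_nth b (n - i))"
  shows "kernel_hull p b"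
proof -
  define q where "q M = p / real (Suc M)" for M
  have q: "q M > 0" "real (Suc M) * q M = p" for M
    using p by (auto simp: q_def)
  have q0: "q \<longlonglongrightarrow> 0"
    unfolding q_def by (rule LIMSEQ_Suc[OF lim_const_over_n])
  define h where "h M = Abs_fps (\<lambda>n. of_real (pochhammer (q M) n) / fact n * m n)" for M
  define H where "H M = h M ^ Suc M" for M
  have "kernel_hull (q M) (h M)" for M
    using m q(1)[of M] by (simp add: kernel_hull_def h_def pochhammer_pos less_imp_neq[symmetric])
  then have H_hull: "kernel_hull p (H M)" for M
    using kernel_hull_power[OF q(1), of M "h M" M] q(2)[of M] by (simp add: H_def)
  have h0: "fps_nth (h M) 0 = 1" for M
    by (simp add: h_def m0)
  \<comment> \<open>The coefficients of \<open>M z h'\<close>, whose limits take the place of \<open>p m\<^sub>i\<close> in the recursion.\<close>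
  define d where "d M i = of_nat (Suc M) * (of_nat i * fps_nth (h M) i)" for M i
  have d_lim: "(\<lambda>M. d M i) \<longlonglongrightarrow> of_real p * m i" if "i > 0" for i
  proof -
    obtain k where i: "i = Suc k" using \<open>i > 0\<close> gr0_implies_Suc by blast
    have "d M i = of_real (p * (\<Prod>j<k. q M + 1 + real j)) / fact k * m i" for M
    proof -
      have "d M i = of_real (real (Suc M) * q M * pochhammer (q M + 1) k) * (of_nat (Suc k) / fact (Suc k)) * m i"
        by (simp add: d_def h_def i pochhammer_rec)
      also have "of_nat (Suc k) / fact (Suc k) = (1 / fact k :: complex)"
        by (simp add: field_simps del: of_nat_Suc)
      also have "pochhammer (q M + 1) k = (\<Prod>j<k. q M + 1 + real j)"
        by (simp add: pochhammer_prod atLeast0LessThan)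
      finally show ?thesis by (simp only: q(2)) simp
    qed
    moreover have "(\<lambda>M. of_real (p * (\<Prod>j<k. q M + 1 + real j)) / fact k * m i) \<longlonglongrightarrow>
        of_real (p * (\<Prod>j<k. 0 + 1 + real j)) / fact k * m i"
      by (intro tendsto_intros q0) simp
    moreover have "(\<Prod>j<k. 0 + 1 + real j) = fact k"
      by (simp add: fact_prod_Suc atLeast0LessThan add_ac)
    ultimately have "(\<lambda>M. d M i) \<longlonglongrightarrow> of_real (p * fact k) / fact k * m i"
      by (simp only:)
    then show ?thesis by simp
  qed
  have h_lim: "(\<lambda>M. fps_nth (h M) i) \<longlonglongrightarrow> 0" if "i > 0" for i
  proof -
    have "(\<lambda>M. 1 / of_nat (Suc M) * (d M i / of_nat i)) \<longlonglongrightarrow> 0 * (of_real p * m i / of_nat i)"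
      by (intro tendsto_intros d_lim that LIMSEQ_Suc[OF lim_1_over_n]) (use that in auto)
    moreover have "1 / of_nat (Suc M) * (d M i / of_nat i) = fps_nth (h M) i" for M
      using that by (simp add: d_def field_simps del: of_nat_Suc)
    ultimately show ?thesis by simp
  qed
  \<comment> \<open>Compare coefficients in \<open>h \<cdot> z H' = M z h' \<cdot> H\<close>, where \<open>H = h\<^sup>M\<close>.\<close>
  have H_rec: "of_nat n * fps_nth (H M) n =
      (\<Sum>i=1..n. (d M i - fps_nth (h M) i * of_nat (n - i)) * fps_nth (H M) (n - i))" for M n
  proof -
    have "h M * fps_XD (H M) = of_nat (Suc M) * fps_XD (h M) * H M"
    proof -
      have "fps_deriv (H M) = of_nat (Suc M) * fps_deriv (h M) * h M ^ M"
        unfolding H_def using fps_deriv_power'[of "h M" "Suc M"] by (simp only: diff_Suc_1)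
      moreover have "H M = h M * h M ^ M"
        by (simp add: H_def)
      ultimately show ?thesis
        by (simp only: fps_XD_def o_apply mult_ac)
    qed
    then have "fps_nth (h M * fps_XD (H M)) n = fps_nth (of_nat (Suc M) * (fps_XD (h M) * H M)) n"
      by (simp only: mult.assoc)
    moreover have XD: "fps_nth (fps_XD A) k = of_nat k * fps_nth A k" for A :: "complex fps" and k
      by (cases k) (simp_all add: fps_XD_def)
    ultimately have "(\<Sum>i=0..n. fps_nth (h M) i * (of_nat (n - i) * fps_nth (H M) (n - i))) =
        (\<Sum>i=0..n. d M i * fps_nth (H M) (n - i))"
      by (simp only: fps_of_nat[symmetric] fps_mult_left_const_nth)
        (simp only: fps_mult_nth XD sum_distrib_left d_def mult.assoc)
    moreover have "d M 0 = 0"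
      by (simp add: d_def)
    ultimately have "of_nat n * fps_nth (H M) n +
          (\<Sum>i=1..n. fps_nth (h M) i * (of_nat (n - i) * fps_nth (H M) (n - i))) =
        (\<Sum>i=1..n. d M i * fps_nth (H M) (n - i))"
      by (simp only: sum.atLeast_Suc_atMost[OF le0] h0) simp
    then show ?thesis
      by (simp only: left_diff_distrib sum_subtractf mult.assoc) (simp only: eq_diff_eq)
  qed
  have H_lim: "(\<lambda>M. fps_nth (H M) n) \<longlonglongrightarrow> fps_nth b n" for n
  proof (induction n rule: less_induct)
    case (less n)
    show ?case
    proof (cases "n = 0")
      case True
      then show ?thesis by (simp add: H_def h0 b0 fps_power_zeroth)
    next
      case False
      have "(\<lambda>M. (\<Sum>i=1..n. (d M i - fps_nth (h M) i * of_nat (n - i)) * fps_nth (H M) (n - i)) / of_nat n)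
         \<longlonglongrightarrow> (\<Sum>i=1..n. (of_real p * m i - 0 * of_nat (n - i)) * fps_nth b (n - i)) / of_nat n"
        by (intro tendsto_intros d_lim h_lim less) (use False in auto)
      also have "(\<Sum>i=1..n. (of_real p * m i - 0 * of_nat (n - i)) * fps_nth b (n - i)) = of_nat n * fps_nth b n"
        using False by (simp add: b sum_distrib_left mult_ac)
      also have "(\<lambda>M. (\<Sum>i=1..n. (d M i - fps_nth (h M) i * of_nat (n - i)) * fps_nth (H M) (n - i)) / of_nat n)
         = (\<lambda>M. fps_nth (H M) n)"
        unfolding H_rec[symmetric] using False by simp
      finally show ?thesis using False by simp
    qed
  qed
  show ?thesis
    unfolding kernel_hull_def
  proof (rule disc_moments_limit)
    show "disc_moments (\<lambda>n. fps_nth (H M) n * fact n / of_real (pochhammer p n))" for M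
      using H_hull by (simp add: kernel_hull_def)
    show "(\<lambda>M. fps_nth (H M) n * fact n / of_real (pochhammer p n)) \<longlonglongrightarrow>
        fps_nth b n * fact n / of_real (pochhammer p n)" for n
      using p by (intro tendsto_intros H_lim) (simp add: pochhammer_pos less_imp_neq[symmetric])
  qed
qed

lemma normalized_expansion_fps:
  assumes "normalized_expansion f a"
  shows "f has_fps_expansion Abs_fps (\<lambda>n. if n = 0 then 0 else if n = 1 then 1 else a n)"
proof (rule has_fps_expansionI)
  have "(\<lambda>n. (if n = 0 then 0 else if n = 1 then 1 else a n) * z ^ n) sums f z"
    if z: "z \<in> ball 0 1" for z
  proof -
    have "(\<lambda>n. (\<lambda>n. (if n = 0 then 0 else if n = 1 then 1 else a n) * z ^ n) (n + 2)) sums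
        (f z - z)"
      using assms z by (simp add: normalized_expansion_def)
    then show ?thesis
      by (subst (asm) sums_iff_shift) (simp add: numeral_2_eq_2)
  qed
  then show "\<forall>\<^sub>F u in nhds 0. (\<lambda>n. fps_nth (Abs_fps (\<lambda>n. if n = 0 then 0 else if n = 1 then 1 else a n)) n * u ^ n) sums f u"
    by (intro eventually_nhds_in_open[of "ball 0 1", THEN eventually_mono]) auto
qed

text \<open>With \<open>g = f(z)/z\<close> one has \<open>z f'/f = 1 + z g'/g\<close>, so starlikeness of order \<open>\<alpha> = 1 - p/2\<close> means that
  \<open>P = 1 + (2/p) z g'/g\<close> has positive real part, and \<open>z g' = (p/2) (P - 1) g\<close> is the recursion of
  \<open>kernel_hull_generator\<close>.\<close>

lemma starlike_kernel_hull:
  assumes \<alpha>: "\<alpha> < 1" and f: "f \<in> starlike_of_order \<alpha>"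
  shows "kernel_hull (2 * (1 - \<alpha>)) (fps_shift 1 (fps_expansion f 0))"
proof -
  define p where "p = 2 * (1 - \<alpha>)"
  have p: "p > 0" using \<alpha> by (simp add: p_def)
  obtain a where hol: "f holomorphic_on ball 0 1" and a: "normalized_expansion f a"
    and nz: "\<And>z. z \<in> ball 0 1 \<Longrightarrow> z \<noteq> 0 \<Longrightarrow> f z \<noteq> 0"
    and re: "\<And>z. z \<in> ball 0 1 \<Longrightarrow> z \<noteq> 0 \<Longrightarrow> \<alpha> < Re (z * deriv f z / f z)"
    using f by (auto simp: starlike_of_order_def normalized_analytic_def)
  have f0: "f 0 = 0" and f1: "deriv f 0 = 1"
    using fps_nth_fps_expansion[OF normalized_expansion_fps[OF a], of 0]
      fps_nth_fps_expansion[OF normalized_expansion_fps[OF a], of 1] by simp_all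
  define g where "g z = (if z = 0 then 1 else f z / z)" for z
  have g: "g holomorphic_on ball 0 1"
    using pole_lemma_open[OF hol open_ball, of 0] by (simp add: f0 f1 g_def[abs_def] cong: if_cong)
  have fg: "f z = z * g z" for z by (simp add: g_def f0)
  have g_nz: "g z \<noteq> 0" if "z \<in> ball 0 1" for z
    using that nz by (auto simp: g_def)
  have g': "(g has_field_derivative deriv g z) (at z)" if "z \<in> ball 0 1" for z
    using holomorphic_derivI[OF g open_ball that] .
  define P where "P z = 1 + of_real (2 / p) * (z * deriv g z / g z)" for z
  have P: "P holomorphic_on ball 0 1"
    unfolding P_def using g g_nz by (intro holomorphic_intros) auto
  have P0: "P 0 = 1" by (simp add: P_def)
  have P_pos: "0 \<le> Re (P z)" if z: "z \<in> ball 0 1" for z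
  proof (cases "z = 0")
    case False
    have "((\<lambda>z. z * g z) has_field_derivative g z + z * deriv g z) (at z)"
      by (rule derivative_eq_intros refl g' z)+ simp
    then have "deriv f z = g z + z * deriv g z"
      unfolding fg[abs_def, symmetric] by (rule DERIV_imp_deriv)
    then have "z * deriv f z / f z = 1 + z * deriv g z / g z"
      using False g_nz[OF z] by (simp add: fg field_simps)
    with re[OF z False] have "Re (z * deriv g z / g z) > \<alpha> - 1"
      by simp
    moreover have "\<alpha> - 1 = - (p / 2)"
      by (simp add: p_def field_simps)
    ultimately have "Re (z * deriv g z / g z) > - (p / 2)"
      by (simp only:)
    then have "2 / p * Re (z * deriv g z / g z) \<ge> 2 / p * (- (p / 2))"
      using p by (intro mult_left_mono) auto
    moreover have "Re (P z) = 1 + 2 / p * Re (z * deriv g z / g z)"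
    proof -
      have "Re (1 + of_real r * x) = 1 + r * Re x" for r x by simp
      then show ?thesis unfolding P_def .
    qed
    ultimately show ?thesis
      using p by simp
  qed (simp add: P0)
  define m where "m n = (if n = 0 then 1 else (deriv ^^ n) P 0 / fact n / 2)" for n
  have m: "disc_moments m"
    unfolding m_def using P P0 P_pos by (rule disc_moments_Caratheodory)
  define G where "G = fps_expansion g 0"
  have G: "g has_fps_expansion G"
    unfolding G_def using g by (intro has_fps_expansion_fps_expansion[of "ball 0 1"]) auto
  have "f has_fps_expansion fps_X * G"
    unfolding fg[abs_def] by (intro fps_expansion_intros G)
  then have FG: "fps_shift 1 (fps_expansion f 0) = G"
    by (simp add: fps_expansion_eqI fps_eq_iff)
  have PP: "P has_fps_expansion fps_expansion P 0"
    using P by (intro has_fps_expansion_fps_expansion[of "ball 0 1"]) auto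
  \<comment> \<open>The two sides of \<open>P g = g + (2/p) z g'\<close> are expanded into power series.\<close>
  have "(\<lambda>z. P z * g z) has_fps_expansion fps_expansion P 0 * G"
    by (intro fps_expansion_intros G PP)
  moreover have "(\<lambda>z. g z + of_real (2 / p) * (z * deriv g z)) has_fps_expansion
      G + fps_const (of_real (2 / p)) * (fps_X * fps_deriv G)"
    by (intro fps_expansion_intros G)
  moreover have "\<forall>\<^sub>F z in nhds 0. P z * g z = g z + of_real (2 / p) * (z * deriv g z)"
    using eventually_nhds_in_open[of "ball 0 1" "0 :: complex"]
    by (simp, elim eventually_mono) (use g_nz in \<open>auto simp: P_def field_simps\<close>)
  ultimately have PG: "fps_expansion P 0 * G = G + fps_const (of_real (2 / p)) * (fps_X * fps_deriv G)"
    using has_fps_expansion_cong[OF _ refl] fps_expansion_unique_complex by metis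
  have "kernel_hull p G"
  proof (rule kernel_hull_generator[OF p m])
    show "m 0 = 1" by (simp add: m_def)
    show "fps_nth G 0 = 1"
      using fps_nth_fps_expansion[OF G, of 0] by (simp add: g_def)
    fix n :: nat assume n: "n > 0"
    have "fps_nth G n + of_real (2 / p) * (of_nat n * fps_nth G n) = fps_nth (fps_expansion P 0 * G) n"
      unfolding PG using n by simp
    also have "\<dots> = (\<Sum>i=0..n. fps_nth (fps_expansion P 0) i * fps_nth G (n - i))"
      by (rule fps_mult_nth)
    also have "\<dots> = fps_nth G n + (\<Sum>i=1..n. fps_nth (fps_expansion P 0) i * fps_nth G (n - i))"
      by (simp add: sum.atLeast_Suc_atMost fps_expansion_def P0)
    also have "(\<Sum>i=1..n. fps_nth (fps_expansion P 0) i * fps_nth G (n - i)) = 2 * (\<Sum>i=1..n. m i * fps_nth G (n - i))"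
      by (simp add: sum_distrib_left m_def fps_expansion_def)
    finally show "of_nat n * fps_nth G n = of_real p * (\<Sum>i=1..n. m i * fps_nth G (n - i))"
      using p by (simp add: field_simps)
  qed
  then show ?thesis by (simp only: FG p_def)
qed

text \<open>Membership in the hull is a family of linear inequalities between Taylor coefficients. It
  passes to convex combinations because Taylor coefficients are linear, and to limits because by
  Cauchy's inequality they are continuous for uniform convergence on one circle; the radius
  \<open>1/2\<close> is arbitrary.\<close>

lemma closed_hull_kernel_hull:
  assumes \<alpha>: "\<alpha> < 1" and f: "f \<in> closed_hull_starlike \<alpha>"
  shows "kernel_hull (2 * (1 - \<alpha>)) (fps_shift 1 (fps_expansion f 0))"
proof -
  define p where "p = 2 * (1 - \<alpha>)"
  define c where "c f n = (deriv ^^ Suc n) f 0 / fact (Suc n) * fact n / of_real (pochhammer p n)"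
    for f :: "complex \<Rightarrow> complex" and n
  define T where "T = {f. f holomorphic_on ball 0 1 \<and> disc_moments (c f)}"
  have c_add: "c (\<lambda>z. f z + g z) n = c f n + c g n"
    if "f holomorphic_on ball 0 1" "g holomorphic_on ball 0 1" for f g n
    using higher_deriv_add[OF that open_ball, of 0 "Suc n"]
    by (simp add: c_def add_divide_distrib distrib_right del: funpow.simps)
  have c_diff: "c (\<lambda>z. f z - g z) n = c f n - c g n"
    if "f holomorphic_on ball 0 1" "g holomorphic_on ball 0 1" for f g n
    using higher_deriv_diff[OF that open_ball, of 0 "Suc n"]
    by (simp add: c_def diff_divide_distrib left_diff_distrib del: funpow.simps)
  have c_cmult: "c (\<lambda>z. u * f z) n = u * c f n" if "f holomorphic_on ball 0 1" for f u n
    using higher_deriv_cmult[OF that _ open_ball, of 0 "Suc n" u]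
    by (simp add: c_def del: funpow.simps)
  have "convex T"
    unfolding convex_def
  proof (intro ballI allI impI)
    fix f g and u v :: real
    assume fg: "f \<in> T" "g \<in> T" and uv: "0 \<le> u" "0 \<le> v" "u + v = 1"
    have hol: "f holomorphic_on ball 0 1" "g holomorphic_on ball 0 1"
      using fg by (auto simp: T_def)
    have eq: "u *\<^sub>R f + v *\<^sub>R g = (\<lambda>z. of_real u * f z + of_real v * g z)"
      by (simp add: fun_eq_iff scaleR_conv_of_real)
    have hol': "(\<lambda>z. of_real u * f z) holomorphic_on ball 0 1" "(\<lambda>z. of_real v * g z) holomorphic_on ball 0 1"
      using hol by (auto intro!: holomorphic_intros)
    have c: "c (u *\<^sub>R f + v *\<^sub>R g) n = of_real u * c f n + of_real v * c g n" for n
      unfolding eq by (simp add: c_add[OF hol'] c_cmult hol)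
    have "disc_moments (c (u *\<^sub>R f + v *\<^sub>R g))"
      unfolding disc_moments_def
    proof (intro allI impI)
      fix N \<phi> assume \<phi>: "\<forall>w. norm w \<le> 1 \<longrightarrow> 0 \<le> Re (\<Sum>n\<le>N. \<phi> n * w ^ n)"
      have "0 \<le> u * Re (\<Sum>n\<le>N. \<phi> n * c f n) + v * Re (\<Sum>n\<le>N. \<phi> n * c g n)"
        using fg uv \<phi> by (intro add_nonneg_nonneg mult_nonneg_nonneg) (auto simp: T_def disc_moments_def simp del: Re_sum)
      also have "\<dots> = Re (of_real u * (\<Sum>n\<le>N. \<phi> n * c f n) + of_real v * (\<Sum>n\<le>N. \<phi> n * c g n))"
        by simp
      also have "of_real u * (\<Sum>n\<le>N. \<phi> n * c f n) + of_real v * (\<Sum>n\<le>N. \<phi> n * c g n)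
          = (\<Sum>n\<le>N. \<phi> n * c (u *\<^sub>R f + v *\<^sub>R g) n)"
        unfolding c by (simp add: sum_distrib_left sum.distrib algebra_simps)
      finally show "0 \<le> Re (\<Sum>n\<le>N. \<phi> n * c (u *\<^sub>R f + v *\<^sub>R g) n)" .
    qed
    then show "u *\<^sub>R f + v *\<^sub>R g \<in> T"
      using hol' by (simp add: T_def) (simp add: eq holomorphic_on_add)
  qed
  moreover have c_expansion: "c f = (\<lambda>n. fps_nth (fps_shift 1 (fps_expansion f 0)) n * fact n / of_real (pochhammer p n))" for f
    by (rule ext) (simp add: c_def fps_expansion_def del: funpow.simps)
  then have "starlike_of_order \<alpha> \<subseteq> T"
    using starlike_kernel_hull[OF \<alpha>]
    by (auto simp: T_def kernel_hull_def p_def starlike_of_order_def normalized_analytic_def)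
  ultimately have hull: "convex hull starlike_of_order \<alpha> \<subseteq> T"
    by (intro hull_minimal)
  have hol: "f holomorphic_on ball 0 1"
    and approx: "\<And>K e. compact K \<Longrightarrow> K \<subseteq> ball 0 1 \<Longrightarrow> e > 0 \<Longrightarrow>
       \<exists>g\<in>convex hull starlike_of_order \<alpha>. \<forall>z\<in>K. dist (g z) (f z) < e"
    using f unfolding closed_hull_starlike_def in_closure_of_ucc_topology by blast+
  have "\<forall>M. \<exists>g\<in>T. \<forall>z\<in>cball 0 (1/2). dist (g z) (f z) < 1 / real (Suc M)"
  proof
    fix M
    show "\<exists>g\<in>T. \<forall>z\<in>cball 0 (1/2). dist (g z) (f z) < 1 / real (Suc M)"
      using approx[of "cball 0 (1/2)" "1 / real (Suc M)"] hull by (auto simp: subset_iff)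
  qed
  then obtain g where g: "\<And>M. g M \<in> T" "\<And>M z. z \<in> cball 0 (1/2) \<Longrightarrow> dist (g M z) (f z) < 1 / real (Suc M)"
    by metis
  have "disc_moments (c f)"
  proof (rule disc_moments_limit)
    show "disc_moments (c (g M))" for M using g(1)[of M] by (simp add: T_def)
    fix n
    have "norm (c (g M) n - c f n) \<le> 1 / real (Suc M) * (fact n * 2 ^ Suc n / \<bar>pochhammer p n\<bar>)" for M
    proof -
      have gM: "g M holomorphic_on ball 0 1" using g(1)[of M] by (simp add: T_def)
      have D: "(\<lambda>z. g M z - f z) holomorphic_on ball 0 1" by (intro holomorphic_intros gM hol)
      have "norm ((deriv ^^ Suc n) (\<lambda>z. g M z - f z) 0) \<le> fact (Suc n) * (1 / real (Suc M)) / (1/2) ^ Suc n"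
      proof (rule Cauchy_inequality)
        show "(\<lambda>z. g M z - f z) holomorphic_on ball 0 (1/2)" using D by (rule holomorphic_on_subset) auto
        show "continuous_on (cball 0 (1/2)) (\<lambda>z. g M z - f z)"
          using D by (intro holomorphic_on_imp_continuous_on holomorphic_on_subset[OF D]) auto
        show "norm (g M z - f z) \<le> 1 / real (Suc M)" if "norm (0 - z) = 1 / 2" for z
          using g(2)[of z M] that by (simp add: dist_norm)
      qed simp
      then have "norm (c (\<lambda>z. g M z - f z) n) \<le> (fact (Suc n) * (1 / real (Suc M)) / (1/2) ^ Suc n) / fact (Suc n) * fact n / \<bar>pochhammer p n\<bar>"
        unfolding c_def norm_divide norm_mult norm_of_real norm_fact
        by (intro divide_right_mono mult_right_mono) auto
      then show ?thesis
        unfolding c_diff[OF gM hol] by (simp add: power_one_over field_simps del: fact_Suc power_Suc of_nat_Suc)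
    qed
    moreover have "(\<lambda>M. 1 / real (Suc M) * (fact n * 2 ^ Suc n / \<bar>pochhammer p n\<bar>)) \<longlonglongrightarrow> 0"
      by (intro tendsto_mult_left_zero LIMSEQ_Suc[OF lim_1_over_n])
    ultimately have "(\<lambda>M. c (g M) n - c f n) \<longlonglongrightarrow> 0"
      by (intro Lim_null_comparison[of "\<lambda>M. c (g M) n - c f n"] always_eventually) auto
    then show "(\<lambda>M. c (g M) n) \<longlonglongrightarrow> c f n"
      by (rule LIM_zero_cancel)
  qed
  then show ?thesis by (simp add: kernel_hull_def c_expansion p_def)
qed

section \<open>The inequality for moments\<close>

lemma norm_le_if_Re_rotations_le:
  assumes "\<And>e. norm e = 1 \<Longrightarrow> Re (e * z) \<le> B"
  shows "norm z \<le> B"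
proof (cases "z = 0")
  case True
  then show ?thesis using assms[of 1] by simp
next
  case False
  then have "norm (cnj z / norm z) = 1" by (simp add: norm_divide)
  moreover have "cnj z / norm z * z = of_real (norm z)"
    using False complex_norm_square[of z] by (simp add: field_simps power2_eq_square)
  ultimately show ?thesis using assms[of "cnj z / norm z"] by simp
qed

lemma disc_moments_norm_le_1:
  assumes c: "disc_moments c" and c0: "c 0 = 1"
  shows "norm (c k) \<le> 1"
proof (rule norm_le_if_Re_rotations_le)
  fix e :: complex assume e: "norm e = 1"
  define \<phi> where "\<phi> n = (if n = 0 then 1 else 0) - (if n = k then e else 0)" for n
  have \<phi>: "(\<Sum>n\<le>k. \<phi> n * x n) = x 0 - e * x k" for x :: "nat \<Rightarrow> complex"
    by (simp add: \<phi>_def left_diff_distrib sum_subtractf mult_delta_left)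
  have "0 \<le> Re (\<Sum>n\<le>k. \<phi> n * c n)"
  proof (rule disc_momentsD[OF c])
    fix w :: complex assume w: "norm w \<le> 1"
    have "Re (e * w ^ k) \<le> norm (e * w ^ k)" by (rule complex_Re_le_cmod)
    also have "\<dots> \<le> 1" using w e by (simp add: norm_mult norm_power power_le_one)
    finally show "0 \<le> Re (\<Sum>n\<le>k. \<phi> n * w ^ n)" unfolding \<phi> by simp
  qed
  then show "Re (e * c k) \<le> 1" unfolding \<phi> by (simp add: c0)
qed

text \<open>Complete the square in \<open>s\<close>; the minimum is attained at \<open>s = (A + cnj B) / 2\<close>.\<close>

lemma bilinear_defect_nonneg:
  fixes s A B :: complex
  assumes "norm A \<le> 1" "norm B \<le> 1"
  shows "0 \<le> 1 + 2 * (norm s)\<^sup>2 + Re (A * B) - 2 * Re (cnj s * A) - 2 * Re (s * B)"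
proof -
  have "1 + 2 * (norm s)\<^sup>2 + Re (A * B) - 2 * Re (cnj s * A) - 2 * Re (s * B) =
      2 * (norm (s - (A + cnj B) / 2))\<^sup>2 + (1 - (norm A)\<^sup>2) / 2 + (1 - (norm B)\<^sup>2) / 2"
    unfolding cmod_power2 by (simp add: field_simps power2_eq_square)
  moreover have "(norm A)\<^sup>2 \<le> 1" "(norm B)\<^sup>2 \<le> 1"
    using assms by (simp_all add: power_le_one)
  ultimately show ?thesis by simp
qed

text \<open>For \<open>\<bar>e\<bar> = 1\<close> and any complex \<open>s\<close>, the functional
  \<open>1 + 2 \<bar>s\<bar>\<^sup>2 + Re (e w\<^bsup>j+k\<^esup> - 2 cnj s e w\<^sup>j - 2 s w\<^sup>k)\<close> is nonnegative on the disc by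
  \<open>bilinear_defect_nonneg\<close> with \<open>A = e w\<^sup>j\<close> and \<open>B = w\<^sup>k\<close>. At the sequence \<open>c\<close>, the
  choice \<open>s = cnj (c k)\<close> cancels the last term against \<open>2 \<bar>s\<bar>\<^sup>2\<close> and leaves
  \<open>1 - Re (e (2 c\<^sub>j c\<^sub>k - c\<^sub>j\<^sub>+\<^sub>k))\<close>.\<close>

lemma disc_moments_Zalcman_2:
  assumes c: "disc_moments c" and c0: "c 0 = 1"
  shows "norm (2 * c j * c k - c (j + k)) \<le> 1"
proof (rule norm_le_if_Re_rotations_le)
  fix e :: complex assume e: "norm e = 1"
  define s where "s = cnj (c k)"
  define \<phi> where "\<phi> n = (if n = 0 then of_real (1 + 2 * (norm s)\<^sup>2) else 0) + (if n = j + k then e else 0)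
     - (if n = j then 2 * cnj s * e else 0) - (if n = k then 2 * s else 0)" for n
  have \<phi>: "(\<Sum>n\<le>j + k. \<phi> n * x n) =
      of_real (1 + 2 * (norm s)\<^sup>2) * x 0 + e * x (j + k) - 2 * cnj s * e * x j - 2 * s * x k"
    for x :: "nat \<Rightarrow> complex"
    by (simp add: \<phi>_def left_diff_distrib distrib_right sum.distrib sum_subtractf mult_delta_left)
  have "0 \<le> Re (\<Sum>n\<le>j + k. \<phi> n * c n)"
  proof (rule disc_momentsD[OF c])
    fix w :: complex assume w: "norm w \<le> 1"
    have "0 \<le> 1 + 2 * (norm s)\<^sup>2 + Re (e * w ^ j * w ^ k) - 2 * Re (cnj s * (e * w ^ j)) - 2 * Re (s * w ^ k)"
      using w e by (intro bilinear_defect_nonneg) (auto simp: norm_mult norm_power power_le_one)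
    also have "\<dots> = Re (of_real (1 + 2 * (norm s)\<^sup>2) * w ^ 0 + e * w ^ (j + k) - 2 * cnj s * e * w ^ j - 2 * s * w ^ k)"
      by (simp add: power_add algebra_simps)
    finally show "0 \<le> Re (\<Sum>n\<le>j + k. \<phi> n * w ^ n)" unfolding \<phi> .
  qed
  then have "0 \<le> Re (of_real (1 + 2 * (norm s)\<^sup>2) + e * c (j + k) - 2 * c k * e * c j - 2 * (cnj (c k) * c k))"
    unfolding \<phi> by (simp add: c0 s_def)
  also have "cnj (c k) * c k = of_real ((norm s)\<^sup>2)"
    by (simp only: s_def complex_mod_cnj complex_norm_square mult.commute)
  also have "Re (of_real (1 + 2 * (norm s)\<^sup>2) + e * c (j + k) - 2 * c k * e * c j - 2 * of_real ((norm s)\<^sup>2))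
      = 1 - Re (e * (2 * c j * c k - c (j + k)))"
    by (simp add: algebra_simps del: of_real_power)
  finally show "Re (e * (2 * c j * c k - c (j + k))) \<le> 1" by simp
qed

text \<open>On \<open>[0, 2]\<close> the left side is convex in \<open>L\<close> and at most \<open>1\<close> at both ends. Outside, it exceeds
  its value at the nearer end by at most the distance to that end, as \<open>\<bar>c\<^sub>j c\<^sub>k\<bar> \<le> 1\<close>.\<close>

lemma disc_moments_Zalcman_bound:
  assumes c: "disc_moments c" "c 0 = 1"
  shows "norm (of_real L * c j * c k - c (j + k)) \<le> (if 0 \<le> L \<and> L \<le> 2 then 1 else \<bar>L - 1\<bar>)"
proof -
  define x where "x = c j * c k"
  define y where "y = c (j + k)"
  have x: "norm x \<le> 1"
    unfolding x_def norm_mult using c by (intro mult_le_one disc_moments_norm_le_1) auto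
  have y: "norm y \<le> 1" and xy: "norm (2 * x - y) \<le> 1"
    using disc_moments_norm_le_1[OF c] disc_moments_Zalcman_2[OF c, of j k]
    by (simp_all add: x_def y_def mult.assoc)
  have "norm (of_real L * x - y) \<le> (if 0 \<le> L \<and> L \<le> 2 then 1 else \<bar>L - 1\<bar>)"
  proof -
    consider "0 \<le> L" "L \<le> 2" | "L < 0" | "2 < L" by linarith
    then show ?thesis
    proof cases
      case 1
      have "of_real L * x - y = of_real (L / 2) * (2 * x - y) - of_real (1 - L / 2) * y"
        by (simp add: field_simps)
      also have "norm \<dots> \<le> norm (of_real (L / 2) * (2 * x - y)) + norm (of_real (1 - L / 2) * y)"
        by (rule norm_triangle_ineq4)
      also have "\<dots> \<le> L / 2 * 1 + (1 - L / 2) * 1"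
        unfolding norm_mult norm_of_real using 1 x y xy by (intro add_mono mult_mono) auto
      finally show ?thesis using 1 by simp
    next
      case 2
      have "norm (of_real L * x - y) \<le> norm (of_real L * x) + norm y"
        by (rule norm_triangle_ineq4)
      also have "\<dots> \<le> - L * 1 + 1"
        unfolding norm_mult norm_of_real using 2 x y by (intro add_mono mult_mono) auto
      finally show ?thesis using 2 by simp
    next
      case 3
      have "of_real L * x - y = of_real (L - 2) * x + (2 * x - y)"
        by (simp add: algebra_simps)
      also have "norm \<dots> \<le> norm (of_real (L - 2) * x) + norm (2 * x - y)"
        by (rule norm_triangle_ineq)
      also have "\<dots> \<le> (L - 2) * 1 + 1"
        unfolding norm_mult norm_of_real using 3 x xy by (intro add_mono mult_mono) auto
      finally show ?thesis using 3 by simp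
    qed
  qed
  then show ?thesis by (simp add: x_def y_def mult.assoc)
qed

section \<open>The coefficients and the extremal functions\<close>

lemma A_coeff_pochhammer:
  assumes "n \<ge> 2"
  shows "A_coeff \<alpha> n = pochhammer (2 * (1 - \<alpha>)) (n - 1) / fact (n - 1)"
proof -
  obtain k where "n = k + 2" using assms le_Suc_ex by (metis add.commute)
  then show ?thesis
    by (simp add: A_coeff_def pochhammer_prod atLeastLessThanSuc_atLeastAtMost)
qed

lemma A_coeff_pos: "\<alpha> < 1 \<Longrightarrow> n \<ge> 2 \<Longrightarrow> A_coeff \<alpha> n > 0"
  by (simp add: A_coeff_pochhammer pochhammer_pos)

lemma closed_hull_coeff_moments:
  assumes \<alpha>: "\<alpha> < 1" and f: "f \<in> closed_hull_starlike \<alpha>" and a: "normalized_expansion f a"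
  obtains c where "disc_moments c" "c 0 = 1" "\<And>n. n \<ge> 2 \<Longrightarrow> a n = of_real (A_coeff \<alpha> n) * c (n - 1)"
proof
  define F where "F = Abs_fps (\<lambda>n. if n = 0 then 0 else if n = 1 then 1 else a n)"
  have F: "fps_expansion f 0 = F"
    unfolding F_def by (intro fps_expansion_eqI normalized_expansion_fps a)
  define p where "p = 2 * (1 - \<alpha>)"
  define c where "c n = fps_nth (fps_shift 1 F) n * fact n / of_real (pochhammer p n)" for n
  show "disc_moments c"
    using closed_hull_kernel_hull[OF \<alpha> f] unfolding kernel_hull_def F c_def p_def .
  show "c 0 = 1"
    by (simp add: c_def F_def)
  show "a n = of_real (A_coeff \<alpha> n) * c (n - 1)" if "n \<ge> 2" for n
  proof -
    have "pochhammer p (n - 1) > 0"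
      using \<alpha> by (simp add: p_def pochhammer_pos)
    then show ?thesis
      using that A_coeff_pochhammer[OF that, of \<alpha>, folded p_def] by (simp add: c_def F_def)
  qed
qed

lemma rotation_starlike_extremal:
  "rotation \<theta> (starlike_extremal \<alpha>) z =
     z * (1 - exp (\<i> * of_real \<theta>) * z) powr - of_real (2 * (1 - \<alpha>))"
  unfolding rotation_def starlike_extremal_def powr_minus exp_minus by (simp add: field_simps)

lemma rotation_extremal_expansion:
  "normalized_expansion (rotation \<theta> (starlike_extremal \<alpha>))
     (\<lambda>n. of_real (A_coeff \<alpha> n) * exp (\<i> * of_real \<theta>) ^ (n - 1))"
  unfolding normalized_expansion_def
proof
  fix z :: complex assume z: "z \<in> ball 0 1"
  define \<omega> where "\<omega> = exp (\<i> * of_real \<theta>)"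
  define p where "p = 2 * (1 - \<alpha>)"
  have "norm (- (\<omega> * z)) < 1"
    using z by (simp add: \<omega>_def norm_mult)
  from gen_binomial_complex[OF this, of "- of_real p"]
  have "(\<lambda>n. ((- of_real p) gchoose n) * (- (\<omega> * z)) ^ n) sums (1 - \<omega> * z) powr - of_real p"
    by simp
  then have "(\<lambda>n. z * (((- of_real p) gchoose n) * (- (\<omega> * z)) ^ n)) sums (z * (1 - \<omega> * z) powr - of_real p)"
    by (rule sums_mult)
  moreover have "z * (((- of_real p) gchoose n) * (- (\<omega> * z)) ^ n) =
      of_real (pochhammer p n / fact n) * \<omega> ^ n * z ^ Suc n" for n
    by (simp add: gbinomial_pochhammer power_minus[of "\<omega> * z"] power_mult_distrib pochhammer_of_real mult_ac
          flip: power_mult_distrib[of "-1" "-1"])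
  ultimately have "(\<lambda>n. of_real (pochhammer p n / fact n) * \<omega> ^ n * z ^ Suc n) sums
      rotation \<theta> (starlike_extremal \<alpha>) z"
    by (simp add: rotation_starlike_extremal \<omega>_def p_def)
  then have "(\<lambda>n. of_real (pochhammer p (Suc n) / fact (Suc n)) * \<omega> ^ Suc n * z ^ Suc (Suc n)) sums
      (rotation \<theta> (starlike_extremal \<alpha>) z - z)"
    by (subst sums_Suc_iff) simp
  then show "(\<lambda>n. of_real (A_coeff \<alpha> (n + 2)) * exp (\<i> * of_real \<theta>) ^ (n + 2 - 1) * z ^ (n + 2)) sums
      (rotation \<theta> (starlike_extremal \<alpha>) z - z)"
    by (simp add: A_coeff_pochhammer \<omega>_def p_def del: fact_Suc)
qed

lemma Re_inverse_one_minus_gt_half: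
  assumes "norm u < 1"
  shows "Re (1 / (1 - u)) > 1 / 2"
proof -
  have "(norm (1 - (1 - u)))\<^sup>2 < 1"
    using assms by (simp add: power_less_one_iff abs_square_less_1)
  then have "(norm (1 - u))\<^sup>2 < 2 * Re (1 - u)"
    unfolding cmod_power2 by (simp add: power2_eq_square algebra_simps)
  moreover have "0 < (norm (1 - u))\<^sup>2" using assms by auto
  moreover have "Re (1 / (1 - u)) = Re (1 - u) / (norm (1 - u))\<^sup>2"
    unfolding Re_divide cmod_power2 by simp
  ultimately show ?thesis by (simp only: less_divide_eq) simp
qed

text \<open>With \<open>u = e\<^bsup>i\<theta>\<^esup> z\<close>, logarithmic differentiation of \<open>z (1 - u)\<^bsup>-p\<^esup>\<close> gives
  \<open>z r'/r = 1 + p u / (1 - u) = 1 - p + p / (1 - u)\<close>, and \<open>Re (1 / (1 - u)) > 1/2\<close>.\<close>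

lemma rotation_extremal_starlike:
  assumes \<alpha>: "\<alpha> < 1"
  shows "rotation \<theta> (starlike_extremal \<alpha>) \<in> starlike_of_order \<alpha>"
proof -
  define \<omega> where "\<omega> = exp (\<i> * of_real \<theta>)"
  define p where "p = 2 * (1 - \<alpha>)"
  define r where "r = rotation \<theta> (starlike_extremal \<alpha>)"
  have r: "r z = z * (1 - \<omega> * z) powr - of_real p" for z
    by (simp add: r_def rotation_starlike_extremal \<omega>_def p_def)
  have \<omega>z: "norm (\<omega> * z) < 1" if "z \<in> ball 0 1" for z
    using that by (simp add: \<omega>_def norm_mult)
  have slit: "1 - \<omega> * z \<notin> \<real>\<^sub>\<le>\<^sub>0" if "z \<in> ball 0 1" for z
    using \<omega>z[OF that] complex_Re_le_cmod[of "\<omega> * z"] by (auto simp: complex_nonpos_Reals_iff)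
  have r_exp: "r z = z * exp (- of_real p * Ln (1 - \<omega> * z))" if "z \<in> ball 0 1" for z
    using slit[OF that] by (auto simp: r powr_def)
  have deriv: "(r has_field_derivative (1 + of_real p * (\<omega> * z) / (1 - \<omega> * z)) * exp (- of_real p * Ln (1 - \<omega> * z))) (at z)"
    if z: "z \<in> ball 0 1" for z
  proof (rule has_field_derivative_transform_within_open[OF _ open_ball z])
    show "((\<lambda>z. z * exp (- of_real p * Ln (1 - \<omega> * z))) has_field_derivative
        (1 + of_real p * (\<omega> * z) / (1 - \<omega> * z)) * exp (- of_real p * Ln (1 - \<omega> * z))) (at z)"
      using slit[OF z] by (auto intro!: derivative_eq_intros simp: field_simps)
  qed (simp add: r_exp)
  have "r holomorphic_on ball 0 1"
    using deriv holomorphic_on_open[OF open_ball] by blast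
  moreover have "r z \<noteq> 0" if "z \<in> ball 0 1 - {0}" for z
    using that r_exp[of z] by simp
  moreover have "\<alpha> < Re (z * deriv r z / r z)" if z: "z \<in> ball 0 1 - {0}" for z
  proof -
    have "deriv r z = (1 + of_real p * (\<omega> * z) / (1 - \<omega> * z)) * exp (- of_real p * Ln (1 - \<omega> * z))"
      using deriv z by (intro DERIV_imp_deriv) auto
    then have "z * deriv r z / r z = 1 + of_real p * (\<omega> * z) / (1 - \<omega> * z)"
      using z r_exp[of z] by simp
    also have "\<dots> = of_real (1 - p) + of_real p * (1 / (1 - \<omega> * z))"
    proof -
      have "1 - \<omega> * z \<noteq> 0" using slit[of z] z by auto
      then show ?thesis by (simp add: field_simps)
    qed
    finally have "Re (z * deriv r z / r z) = 1 - p + p * Re (1 / (1 - \<omega> * z))"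
      by (simp only: plus_complex.sel Re_complex_of_real times_complex.sel Im_complex_of_real)
    moreover have "p * Re (1 / (1 - \<omega> * z)) > p * (1 / 2)"
      using Re_inverse_one_minus_gt_half[OF \<omega>z] z \<alpha> by (intro mult_strict_left_mono) (auto simp: p_def)
    moreover have "1 - p + p * (1 / 2) = \<alpha>" by (simp add: p_def field_simps)
    ultimately show ?thesis by linarith
  qed
  ultimately show ?thesis
    using rotation_extremal_expansion[of \<theta> \<alpha>]
    unfolding starlike_of_order_def normalized_analytic_def r_def[symmetric] by blast
qed

lemma starlike_subset_closed_hull: "starlike_of_order \<alpha> \<subseteq> closed_hull_starlike \<alpha>"
proof
  fix f assume f: "f \<in> starlike_of_order \<alpha>"
  then have "f holomorphic_on unit_disc"
    by (simp add: starlike_of_order_def normalized_analytic_def)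
  then show "f \<in> closed_hull_starlike \<alpha>"
    unfolding closed_hull_starlike_def in_closure_of_ucc_topology
    using hull_inc[OF f, of convex] by (auto intro!: bexI[of _ f])
qed

theorem theorem2p1:
  fixes \<alpha> lam :: real
    and f :: "complex \<Rightarrow> complex"
    and a :: "nat \<Rightarrow> complex"
  assumes "\<alpha> < 1"
    and "f \<in> closed_hull_starlike \<alpha>"
    and "normalized_expansion f a"
  shows
    "(\<forall>n\<ge>2. \<forall>m\<ge>2.
        norm (complex_of_real lam * a n * a m - a (n + m - 1)) \<le>
          (if 0 \<le> lam \<and> lam \<le> 2 * A_coeff \<alpha> (n + m - 1) / (A_coeff \<alpha> n * A_coeff \<alpha> m)
           then A_coeff \<alpha> (n + m - 1)
           else \<bar>lam * A_coeff \<alpha> n * A_coeff \<alpha> m - A_coeff \<alpha> (n + m - 1)\<bar>)) \<and>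
     (\<forall>\<theta>. rotation \<theta> (starlike_extremal \<alpha>) \<in> closed_hull_starlike \<alpha> \<and>
        (\<exists>b. normalized_expansion (rotation \<theta> (starlike_extremal \<alpha>)) b \<and>
           (\<forall>n\<ge>2. \<forall>m\<ge>2.
              lam < 0 \<or> lam > 2 * A_coeff \<alpha> (n + m - 1) / (A_coeff \<alpha> n * A_coeff \<alpha> m) \<longrightarrow>
              norm (complex_of_real lam * b n * b m - b (n + m - 1)) =
                \<bar>lam * A_coeff \<alpha> n * A_coeff \<alpha> m - A_coeff \<alpha> (n + m - 1)\<bar>)))"
proof (intro conjI allI impI)
  obtain c where c: "disc_moments c" "c 0 = 1"
    and a: "\<And>n. n \<ge> 2 \<Longrightarrow> a n = of_real (A_coeff \<alpha> n) * c (n - 1)"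
    using closed_hull_coeff_moments[OF assms] by metis
  fix n m :: nat assume nm: "n \<ge> 2" "m \<ge> 2"
  define A B C where "A = A_coeff \<alpha> n" and "B = A_coeff \<alpha> m" and "C = A_coeff \<alpha> (n + m - 1)"
  have pos: "A > 0" "B > 0" "C > 0"
    using nm \<open>\<alpha> < 1\<close> by (simp_all add: A_def B_def C_def A_coeff_pos)
  define L where "L = lam * A * B / C"
  have idx: "n + m - 1 - 1 = (n - 1) + (m - 1)" "n + m - 1 \<ge> 2"
    using nm by auto
  have "of_real lam * a n * a m - a (n + m - 1) =
      of_real C * (of_real L * c (n - 1) * c (m - 1) - c ((n - 1) + (m - 1)))"
  proof -
    have "a n = of_real A * c (n - 1)" "a m = of_real B * c (m - 1)"
      "a (n + m - 1) = of_real C * c ((n - 1) + (m - 1))"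
      using a[OF nm(1)] a[OF nm(2)] a[OF idx(2)] by (simp_all only: A_def B_def C_def idx(1))
    moreover have "of_real C * of_real L = (of_real lam * of_real A * of_real B :: complex)"
      using pos by (simp add: L_def)
    ultimately show ?thesis
      by (simp add: right_diff_distrib mult_ac del: of_real_mult)
  qed
  then have "norm (of_real lam * a n * a m - a (n + m - 1)) =
      C * norm (of_real L * c (n - 1) * c (m - 1) - c ((n - 1) + (m - 1)))"
    using pos by (simp only: norm_mult norm_of_real abs_of_pos)
  also have "\<dots> \<le> C * (if 0 \<le> L \<and> L \<le> 2 then 1 else \<bar>L - 1\<bar>)"
    using pos by (intro mult_left_mono disc_moments_Zalcman_bound c) simp
  also have "\<dots> = (if 0 \<le> L \<and> L \<le> 2 then C else \<bar>lam * A * B - C\<bar>)"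
    using pos by (simp add: L_def abs_mult_pos' field_simps)
  also have "0 \<le> L \<longleftrightarrow> 0 \<le> lam"
    using pos by (simp add: L_def zero_le_mult_iff zero_le_divide_iff)
  also have "L \<le> 2 \<longleftrightarrow> lam \<le> 2 * C / (A * B)"
    using pos by (simp add: L_def field_simps)
  finally show "norm (complex_of_real lam * a n * a m - a (n + m - 1)) \<le>
          (if 0 \<le> lam \<and> lam \<le> 2 * A_coeff \<alpha> (n + m - 1) / (A_coeff \<alpha> n * A_coeff \<alpha> m)
           then A_coeff \<alpha> (n + m - 1)
           else \<bar>lam * A_coeff \<alpha> n * A_coeff \<alpha> m - A_coeff \<alpha> (n + m - 1)\<bar>)"
    by (simp only: A_def B_def C_def)
next
  fix \<theta>
  show "rotation \<theta> (starlike_extremal \<alpha>) \<in> closed_hull_starlike \<alpha>"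
    using rotation_extremal_starlike[OF \<open>\<alpha> < 1\<close>] starlike_subset_closed_hull by blast
  define \<omega> where "\<omega> = exp (\<i> * of_real \<theta>)"
  define b where "b n = of_real (A_coeff \<alpha> n) * \<omega> ^ (n - 1)" for n
  have "norm (complex_of_real lam * b n * b m - b (n + m - 1)) =
      \<bar>lam * A_coeff \<alpha> n * A_coeff \<alpha> m - A_coeff \<alpha> (n + m - 1)\<bar>" if nm: "n \<ge> 2" "m \<ge> 2" for n m
  proof -
    have "n + m - 1 - 1 = (n - 1) + (m - 1)" using nm by simp
    then have "complex_of_real lam * b n * b m - b (n + m - 1) =
        of_real (lam * A_coeff \<alpha> n * A_coeff \<alpha> m - A_coeff \<alpha> (n + m - 1)) * (\<omega> ^ (n - 1) * \<omega> ^ (m - 1))"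
      unfolding b_def by (simp only: power_add) (simp add: algebra_simps)
    then show ?thesis
      by (simp only: norm_mult norm_power norm_of_real) (simp add: \<omega>_def)
  qed
  moreover have "normalized_expansion (rotation \<theta> (starlike_extremal \<alpha>)) b"
    using rotation_extremal_expansion unfolding b_def \<omega>_def .
  ultimately show "\<exists>b. normalized_expansion (rotation \<theta> (starlike_extremal \<alpha>)) b \<and>
           (\<forall>n\<ge>2. \<forall>m\<ge>2.
              lam < 0 \<or> lam > 2 * A_coeff \<alpha> (n + m - 1) / (A_coeff \<alpha> n * A_coeff \<alpha> m) \<longrightarrow>
              norm (complex_of_real lam * b n * b m - b (n + m - 1)) =
                \<bar>lam * A_coeff \<alpha> n * A_coeff \<alpha> m - A_coeff \<alpha> (n + m - 1)\<bar>)"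
    by blast
qed

end
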